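(* Let $n>k\ge 1$ be integers, let $\boldsymbol{X}\in\mathbb{R}^{n\times k}$ have rank $k$, let $\boldsymbol{K}\in\mathbb{R}^{k\times k}$ be symmetric positive semidefinite, and let $\boldsymbol{W}\in\mathbb{R}^{n\times n}$ be a spatial weights matrix. Let $\rho\in\mathbb{R}$ with $\rho\neq 0$, and let $\boldsymbol{\Omega}$ be one of the following two matrices: $$\boldsymbol{\Omega}=(\boldsymbol{I}_n-\rho\boldsymbol{W})^{-1}(\boldsymbol{I}_n-\rho\boldsymbol{W}^\top)^{-1}\ \text{ (where $\boldsymbol{I}_n-\rho\boldsymbol{W}$ is nonsingular)},$$ $$\boldsymbol{\Omega}=(\boldsymbol{I}_n+\rho\boldsymbol{W})(\boldsymbol{I}_n+\rho\boldsymbol{W}^\top)\ \text{ (where $\boldsymbol{I}_n+\rho\boldsymbol{W}$ is nonsingular)}.$$ If $$\mathcal{C}\begin{pmatrix}\boldsymbol{W}\boldsymbol{X}\\ \boldsymbol{0}\end{pmatrix}\subseteq\mathcal{C}\begin{pmatrix}\boldsymbol{X}\\ \boldsymbol{K}\end{pmatrix}\quad\text{and}\quad \mathcal{C}\begin{pmatrix}\boldsymbol{W}^\top\boldsymbol{X}\\ \boldsymbol{0}\end{pmatrix}\subseteq\mathcal{C}\begin{pmatrix}\boldsymbol{X}\\ \boldsymbol{K}\end{pmatrix},$$ then $\hat{\boldsymbol{\beta}}_{GR}(\boldsymbol{\Omega},\boldsymbol{K})=\hat{\boldsymbol{\beta}}_{GR}(\boldsymbol{I}_n,\boldsymbol{K})$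 for all $\boldsymbol{y}\in\mathbb{R}^n$.
   Context: $\mathcal{C}(\boldsymbol{A})$ denotes the column space of a real matrix $\boldsymbol{A}$; the zero block $\boldsymbol{0}$ in the stacked matrices is $k\times k$, and $\boldsymbol{I}_m$ is the $m\times m$ identity matrix. A spatial weights matrix is a matrix $\boldsymbol{W}=(w_{ij})\in\mathbb{R}^{n\times n}$ with $w_{ij}\ge 0$ (not necessarily symmetric). For a symmetric positive definite $\boldsymbol{\Phi}\in\mathbb{R}^{n\times n}$ and $\boldsymbol{y}\in\mathbb{R}^n$, the general ridge estimator is $$\hat{\boldsymbol{\beta}}_{GR}(\boldsymbol{\Phi},\boldsymbol{K})=(\boldsymbol{X}^\top\boldsymbol{\Phi}^{-1}\boldsymbol{X}+\boldsymbol{K})^{-1}\boldsymbol{X}^\top\boldsymbol{\Phi}^{-1}\boldsymbol{y}\in\mathbb{R}^k .$$ The first form of $\boldsymbol{\Omega}$ corresponds to a first-order spatial autoregressive (SAR(1)) disturbance process, the second to a first-order spatial moving average (SMA(1)) process. *)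

theory Defs
  imports "HOL-Analysis.Analysis"
begin

definition column_space :: "real ^ 'n ^ 'm \<Rightarrow> (real ^ 'm) set" where
  "column_space A = span (columns A)"

definition stack_rows :: "real ^ 'k ^ 'n \<Rightarrow> real ^ 'k ^ 'm \<Rightarrow> real ^ 'k ^ ('n + 'm)" where
  "stack_rows A B = (\<chi> i. case i of Inl r \<Rightarrow> A $ r | Inr s \<Rightarrow> B $ s)"

definition symmetric_mat :: "real ^ 'n ^ 'n \<Rightarrow> bool" where
  "symmetric_mat A \<longleftrightarrow> transpose A = A"

definition sym_pos_semidef :: "real ^ 'n ^ 'n \<Rightarrow> bool" where
  "sym_pos_semidef A \<longleftrightarrow> symmetric_mat A \<and> (\<forall>v. v \<bullet> (A *v v) \<ge> 0)"

definition spatial_weights_mat :: "real ^ 'n ^ 'n \<Rightarrow> bool" where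
  "spatial_weights_mat W \<longleftrightarrow> (\<forall>i j. W $ i $ j \<ge> 0)"

text \<open>
  The general ridge estimator. It is meant for symmetric positive definite \<open>\<Phi>\<close>, \<open>X\<close> of full
  column rank and symmetric positive semidefinite \<open>K\<close>; both matrices inverted below are then
  nonsingular, and \<^const>\<open>matrix_inv\<close> is the true inverse.
\<close>

definition ridge_estimator ::
  "real ^ 'k ^ 'n \<Rightarrow> real ^ 'n ^ 'n \<Rightarrow> real ^ 'k ^ 'k \<Rightarrow> real ^ 'n \<Rightarrow> real ^ 'k" where
  "ridge_estimator X \<Phi> K y =
     matrix_inv (transpose X ** matrix_inv \<Phi> ** X + K) *v
       (transpose X *v (matrix_inv \<Phi> *v y))"

definition sar_cov :: "real \<Rightarrow> real ^ 'n ^ 'n \<Rightarrow> real ^ 'n ^ 'n" where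
  "sar_cov \<rho> W = matrix_inv (mat 1 - \<rho> *\<^sub>R W) ** matrix_inv (mat 1 - \<rho> *\<^sub>R transpose W)"

definition sma_cov :: "real \<Rightarrow> real ^ 'n ^ 'n \<Rightarrow> real ^ 'n ^ 'n" where
  "sma_cov \<rho> W = (mat 1 + \<rho> *\<^sub>R W) ** (mat 1 + \<rho> *\<^sub>R transpose W)"

end

theory Submission
  imports Defs
begin

text \<open>
  The two column space inclusions say that there are \<open>k \<times> k\<close> matrices \<open>A\<close>, \<open>B\<close> with
  \<open>W X = X A\<close>, \<open>W\<^sup>T X = X B\<close> and \<open>K A = K B = 0\<close>: the columns of \<open>X\<close> span a space
  invariant under \<open>W\<close> and \<open>W\<^sup>T\<close>, and the induced coefficient maps go into the kernel
  of \<open>K\<close>. The property ``\<open>\<Psi> X = X D\<close> for some \<open>D\<close> with \<open>K D = K\<close>'' therefore holds for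
  \<open>\<Psi> = I + c W\<close> and \<open>\<Psi> = I + c W\<^sup>T\<close>, and it passes to products and, as \<open>X\<close> has full column
  rank, to inverses. So it holds for \<open>\<Omega>\<^sup>-\<^sup>1\<close> under both disturbance processes.

  Given such a \<open>D\<close> for the symmetric matrix \<open>\<Psi> = \<Omega>\<^sup>-\<^sup>1\<close>, transposition gives
  \<open>X\<^sup>T \<Psi> = D\<^sup>T X\<^sup>T\<close> and \<open>K = D\<^sup>T K\<close>. Hence the normal equations
  \<open>(X\<^sup>T \<Psi> X + K) \<beta> = X\<^sup>T \<Psi> y\<close> are the normal equations
  \<open>(X\<^sup>T X + K) \<beta> = X\<^sup>T y\<close> multiplied from the left by \<open>D\<^sup>T\<close>
  (lemma \<open>ridge_estimator_eq_if_intertwines\<close>). As \<open>D\<close> is invertible, the solution is the same.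
\<close>

section \<open>Matrix algebra\<close>

lemma matrix_inv_unique:
  fixes A B :: "real ^ 'n ^ 'n"
  assumes "A ** B = mat 1"
  shows "matrix_inv A = B"
proof -
  have "\<exists>C. A ** C = mat 1 \<and> C ** A = mat 1"
    using assms matrix_left_right_inverse by blast
  then have "matrix_inv A ** A = mat 1"
    unfolding matrix_inv_def by (rule someI2_ex) simp
  then have "matrix_inv A ** A ** B = B"
    by simp
  with assms show ?thesis
    by (simp add: matrix_mul_assoc [symmetric])
qed

lemma invertible_matrix_inv:
  fixes A :: "real ^ 'n ^ 'n"
  assumes "invertible A"
  shows "A ** matrix_inv A = mat 1" "matrix_inv A ** A = mat 1"
  using assms matrix_inv_unique unfolding invertible_def by metis+

lemma transpose_add: "transpose (A + B) = transpose A + transpose (B :: real ^ 'n ^ 'm)"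
  by (simp add: transpose_def vec_eq_iff)

lemma matrix_add_rdistrib:
  fixes A B :: "real ^ 'n ^ 'm" and C :: "real ^ 'p ^ 'n"
  shows "(A + B) ** C = A ** C + B ** C"
  by (simp add: matrix_matrix_mult_def vec_eq_iff distrib_right sum.distrib)

lemma invertible_if_kernel_trivial:
  fixes A :: "real ^ 'n ^ 'n"
  assumes "\<And>v. A *v v = 0 \<Longrightarrow> v = 0"
  shows "invertible A"
  using assms matrix_left_invertible_ker [of A] invertible_left_inverse [of A] by blast

lemma column_space_subset_imp_factor:
  assumes "column_space M \<subseteq> column_space N"
  shows "\<exists>A. M = N ** A"
proof -
  have "\<exists>v. column j M = N *v v" for j
  proof -
    have "column j M \<in> column_space M"
      unfolding column_space_def by (rule span_base) (auto simp: columns_def)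
    with assms have "column j M \<in> span (columns N)"
      unfolding column_space_def by (rule subsetD)
    moreover have "span (columns N) \<subseteq> range ((*v) N)"
    proof (rule span_minimal)
      show "columns N \<subseteq> range ((*v) N)"
        unfolding columns_def by clarify (metis matrix_vector_mult_basis rangeI)
      show "subspace (range ((*v) N))"
        by (simp add: linear_subspace_image)
    qed
    ultimately show ?thesis by blast
  qed
  then obtain f where f: "\<And>j. column j M = N *v f j" by metis
  have "M = N ** (\<chi> i j. f j $ i)"
    using f by (simp add: vec_eq_iff column_def matrix_matrix_mult_def matrix_vector_mult_def)
  then show ?thesis ..
qed

lemma stack_rows_mult: "stack_rows X K ** A = stack_rows (X ** A) (K ** A)"
  by (auto simp: stack_rows_def matrix_matrix_mult_def vec_eq_iff split: sum.split)

lemma stack_rows_eq_iff: "stack_rows A B = stack_rows A' B' \<longleftrightarrow> A = A' \<and> B = B'"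
proof
  assume eq: "stack_rows A B = stack_rows A' B'"
  have "A $ r = A' $ r" "B $ s = B' $ s" for r s
    using arg_cong [OF eq, of "\<lambda>M. M $ Inl r"] arg_cong [OF eq, of "\<lambda>M. M $ Inr s"]
    by (simp_all add: stack_rows_def)
  then show "A = A' \<and> B = B'"
    by (simp add: vec_eq_iff)
qed simp

section \<open>Intertwining with the design matrix\<close>

text \<open>
  \<open>\<Psi>\<close> acts on the columns of \<open>X\<close> through a matrix \<open>D\<close> of coefficients that leaves the
  penalty matrix \<open>K\<close> fixed; equivalently \<open>D - I\<close> maps into the kernel of \<open>K\<close>.
\<close>

definition intertwines ::
  "real ^ 'k ^ 'n \<Rightarrow> real ^ 'k ^ 'k \<Rightarrow> real ^ 'n ^ 'n \<Rightarrow> real ^ 'k ^ 'k \<Rightarrow> bool" where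
  "intertwines X K \<Psi> D \<longleftrightarrow> \<Psi> ** X = X ** D \<and> K ** D = K"

lemma intertwines_mult:
  assumes "intertwines X K \<Psi> D" "intertwines X K \<Psi>' D'"
  shows "intertwines X K (\<Psi> ** \<Psi>') (D ** D')"
  using assms unfolding intertwines_def by (metis matrix_mul_assoc)

text \<open>
  Reading the two blocks of the inclusion separately gives \<open>A\<close> with \<open>W X = X A\<close> and
  \<open>K A = 0\<close>; then \<open>D = I + c A\<close>.
\<close>

lemma intertwines_shift:
  fixes W :: "real ^ 'n ^ 'n" and X :: "real ^ 'k ^ 'n"
  assumes "column_space (stack_rows (W ** X) (0 :: real ^ 'k ^ 'k)) \<subseteq> column_space (stack_rows X K)"
  shows "\<exists>D. intertwines X K (mat 1 + c *\<^sub>R W) D"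
proof -
  obtain A where "stack_rows (W ** X) 0 = stack_rows X K ** A"
    using column_space_subset_imp_factor [OF assms] by blast
  then have A: "W ** X = X ** A" "K ** A = 0"
    by (simp_all add: stack_rows_mult stack_rows_eq_iff)
  have "(mat 1 + c *\<^sub>R W) ** X = X + c *\<^sub>R (W ** X)"
    by (simp add: matrix_add_rdistrib scalar_matrix_assoc)
  then have "intertwines X K (mat 1 + c *\<^sub>R W) (mat 1 + c *\<^sub>R A)"
    using A by (simp add: intertwines_def matrix_add_ldistrib matrix_scalar_ac
        flip: scalar_matrix_assoc)
  then show ?thesis ..
qed

text \<open>
  If \<open>D v = 0\<close> then \<open>\<Psi> X v = X D v = 0\<close>, and both \<open>\<Psi>\<close> and \<open>X\<close> are injective.
\<close>

lemma intertwines_invertible: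
  assumes "intertwines X K \<Psi> D" and "inj ((*v) X)" and "invertible \<Psi>"
  shows "invertible D"
proof (rule invertible_if_kernel_trivial)
  fix v
  assume "D *v v = 0"
  then have "\<Psi> *v (X *v v) = 0"
    using assms(1) unfolding intertwines_def
    by (metis matrix_vector_mul_assoc matrix_vector_mult_0_right)
  then have "X *v v = 0"
    using invertible_matrix_inv(2) [OF assms(3)]
    by (metis matrix_vector_mul_assoc matrix_vector_mul_lid matrix_vector_mult_0_right)
  then show "v = 0"
    using assms(2) by (metis injD matrix_vector_mult_0_right)
qed

lemma intertwines_inverse:
  assumes "intertwines X K \<Psi> D" and "inj ((*v) X)" and "invertible \<Psi>"
  shows "intertwines X K (matrix_inv \<Psi>) (matrix_inv D)"
proof -
  note inv = invertible_matrix_inv [OF assms(3)]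
    invertible_matrix_inv [OF intertwines_invertible [OF assms]]
  have "matrix_inv \<Psi> ** X = matrix_inv \<Psi> ** (X ** D) ** matrix_inv D"
    by (metis inv(3) matrix_mul_assoc matrix_mul_rid)
  also have "\<dots> = X ** matrix_inv D"
    using assms(1) unfolding intertwines_def by (metis inv(2) matrix_mul_assoc matrix_mul_lid)
  finally show ?thesis
    using assms(1) unfolding intertwines_def by (metis inv(3) matrix_mul_assoc matrix_mul_rid)
qed

section \<open>The ridge estimator\<close>

text \<open>
  If \<open>v\<close> is in the kernel, then \<open>0 = v\<^sup>T (X\<^sup>T X + K) v = \<parallel>X v\<parallel>\<^sup>2 + v\<^sup>T K v\<close>, a sum of two
  nonnegative terms; so \<open>X v = 0\<close>.
\<close>

lemma ridge_gram_invertible: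
  fixes X :: "real ^ 'k ^ 'n"
  assumes "inj ((*v) X)" and "sym_pos_semidef K"
  shows "invertible (transpose X ** X + K)"
proof (rule invertible_if_kernel_trivial)
  fix v
  assume "(transpose X ** X + K) *v v = 0"
  then have "0 = v \<bullet> ((transpose X ** X) *v v + K *v v)"
    by (simp add: matrix_vector_mult_add_rdistrib)
  also have "\<dots> = (X *v v) \<bullet> (X *v v) + v \<bullet> (K *v v)"
    by (simp add: inner_add_right inner_commute flip: matrix_vector_mul_assoc dot_lmul_matrix)
  finally have "(X *v v) \<bullet> (X *v v) + v \<bullet> (K *v v) = 0"
    by (rule sym)
  moreover have "v \<bullet> (K *v v) \<ge> 0"
    using assms(2) unfolding sym_pos_semidef_def by blast
  ultimately have "X *v v = 0"
    by (metis add_nonneg_eq_0_iff inner_eq_zero_iff inner_ge_zero)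
  then show "v = 0"
    using assms(1) by (metis injD matrix_vector_mult_0_right)
qed

text \<open>
  Both estimators solve normal equations, and those for \<open>\<Phi>\<close> are the ones for the identity
  multiplied by the invertible matrix \<open>D\<^sup>T\<close>: the symmetry of \<open>\<Psi>\<close> and \<open>K\<close> turns
  \<open>\<Psi> X = X D\<close>, \<open>K D = K\<close> into \<open>X\<^sup>T \<Psi> = D\<^sup>T X\<^sup>T\<close>, \<open>K = D\<^sup>T K\<close>.
\<close>

lemma ridge_estimator_eq_if_intertwines:
  fixes X :: "real ^ 'k ^ 'n"
  assumes inj: "inj ((*v) X)" and K: "sym_pos_semidef K"
    and inv: "\<Phi> ** \<Psi> = mat 1" and sym: "transpose \<Psi> = \<Psi>"
    and D: "intertwines X K \<Psi> D"
  shows "ridge_estimator X \<Phi> K y = ridge_estimator X (mat 1) K y"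
proof -
  let ?N = "transpose X ** X + K"
  have XD: "transpose X ** \<Psi> = transpose D ** transpose X"
    using D sym unfolding intertwines_def by (metis matrix_transpose_mul)
  have KD: "transpose D ** K = K"
    using D K unfolding intertwines_def sym_pos_semidef_def symmetric_mat_def
    by (metis matrix_transpose_mul)
  have "invertible \<Psi>"
    using inv matrix_left_right_inverse unfolding invertible_def by blast
  then have inv_D: "transpose D ** matrix_inv (transpose D) = mat 1"
      "matrix_inv (transpose D) ** transpose D = mat 1"
    using intertwines_invertible [OF D inj]
    by (simp_all add: invertible_matrix_inv transpose_invertible)
  have gram: "transpose X ** \<Psi> ** X + K = transpose D ** ?N"
    by (simp add: XD KD matrix_add_ldistrib matrix_mul_assoc)
  have "transpose D ** ?N ** (matrix_inv ?N ** matrix_inv (transpose D)) = mat 1"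
    using invertible_matrix_inv(1) [OF ridge_gram_invertible [OF inj K]] inv_D(1)
    by (metis matrix_mul_assoc matrix_mul_rid)
  then have gram_inv:
    "matrix_inv (transpose X ** \<Psi> ** X + K) = matrix_inv ?N ** matrix_inv (transpose D)"
    unfolding gram by (rule matrix_inv_unique)
  have "ridge_estimator X \<Phi> K y
      = matrix_inv ?N *v ((matrix_inv (transpose D) ** (transpose X ** \<Psi>)) *v y)"
    by (simp add: ridge_estimator_def matrix_inv_unique [OF inv] gram_inv
        matrix_vector_mul_assoc matrix_mul_assoc)
  also have "\<dots> = matrix_inv ?N *v (transpose X *v y)"
    by (simp add: XD matrix_mul_assoc inv_D)
  also have "\<dots> = ridge_estimator X (mat 1) K y"
    by (simp add: ridge_estimator_def matrix_inv_unique)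
  finally show ?thesis .
qed

theorem theorem3p2:
  fixes X :: "real ^ 'k ^ 'n" and K :: "real ^ 'k ^ 'k"
    and W \<Omega> :: "real ^ 'n ^ 'n" and \<rho> :: real
  assumes "CARD('k) < CARD('n)"
    and "rank X = CARD('k)"
    and "sym_pos_semidef K"
    and "spatial_weights_mat W"
    and "\<rho> \<noteq> 0"
    and "invertible (mat 1 - \<rho> *\<^sub>R W) \<and> \<Omega> = sar_cov \<rho> W \<or>
         invertible (mat 1 + \<rho> *\<^sub>R W) \<and> \<Omega> = sma_cov \<rho> W"
    and "column_space (stack_rows (W ** X) (0 :: real ^ 'k ^ 'k)) \<subseteq> column_space (stack_rows X K)"
    and "column_space (stack_rows (transpose W ** X) (0 :: real ^ 'k ^ 'k))
           \<subseteq> column_space (stack_rows X K)"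
  shows "\<forall>y. ridge_estimator X \<Omega> K y = ridge_estimator X (mat 1) K y"
proof -
  have inj: "inj ((*v) X)"
    using assms(2) by (simp add: full_rank_injective)
  define P where "P c = mat 1 + c *\<^sub>R W" for c
  have transpose_P: "transpose (P c) = mat 1 + c *\<^sub>R transpose W" for c
    by (simp add: P_def transpose_add transpose_scalar)
  have P: "\<exists>D. intertwines X K (P c) D" and P': "\<exists>D. intertwines X K (transpose (P c)) D" for c
    unfolding transpose_P unfolding P_def
    by (rule intertwines_shift [OF assms(7)], rule intertwines_shift [OF assms(8)])
  have "\<exists>\<Psi> D. \<Omega> ** \<Psi> = mat 1 \<and> transpose \<Psi> = \<Psi> \<and> intertwines X K \<Psi> D"
    using assms(6)
  proof (elim disjE conjE)
    let ?P = "P (- \<rho>)"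
    assume "invertible (mat 1 - \<rho> *\<^sub>R W)"
    then have inv: "invertible ?P"
      by (simp add: P_def)
    assume "\<Omega> = sar_cov \<rho> W"
    then have "\<Omega> = matrix_inv ?P ** matrix_inv (transpose ?P)"
      unfolding sar_cov_def transpose_P by (simp add: P_def)
    then have "\<Omega> ** (transpose ?P ** ?P)
        = matrix_inv ?P ** (matrix_inv (transpose ?P) ** transpose ?P) ** ?P"
      by (simp add: matrix_mul_assoc)
    then have "\<Omega> ** (transpose ?P ** ?P) = mat 1"
      using inv by (simp add: invertible_matrix_inv transpose_invertible)
    moreover have "transpose (transpose ?P ** ?P) = transpose ?P ** ?P"
      by (simp add: matrix_transpose_mul)
    moreover obtain D D' where "intertwines X K ?P D" "intertwines X K (transpose ?P) D'"
      using P P' by blast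
    then have "intertwines X K (transpose ?P ** ?P) (D' ** D)"
      by (simp add: intertwines_mult)
    ultimately show ?thesis
      by blast
  next
    let ?P = "P \<rho>"
    assume "invertible (mat 1 + \<rho> *\<^sub>R W)"
    then have inv: "invertible ?P"
      by (simp add: P_def)
    assume "\<Omega> = sma_cov \<rho> W"
    then have \<Omega>: "\<Omega> = ?P ** transpose ?P"
      unfolding sma_cov_def transpose_P by (simp add: P_def)
    then have inv_\<Omega>: "invertible \<Omega>"
      using inv by (simp add: invertible_mult transpose_invertible)
    obtain D D' where "intertwines X K ?P D" "intertwines X K (transpose ?P) D'"
      using P P' by blast
    then have "intertwines X K \<Omega> (D ** D')"
      unfolding \<Omega> by (rule intertwines_mult)
    then have "intertwines X K (matrix_inv \<Omega>) (matrix_inv (D ** D'))"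
      using inj inv_\<Omega> by (rule intertwines_inverse)
    moreover have "transpose (matrix_inv \<Omega>) = matrix_inv \<Omega>"
    proof -
      have "transpose \<Omega> = \<Omega>"
        unfolding \<Omega> by (simp add: matrix_transpose_mul)
      then have "\<Omega> ** transpose (matrix_inv \<Omega>) = mat 1"
        using invertible_matrix_inv(2) [OF inv_\<Omega>] by (metis matrix_transpose_mul transpose_mat)
      then show ?thesis
        by (rule matrix_inv_unique [symmetric])
    qed
    ultimately show ?thesis
      using invertible_matrix_inv(1) [OF inv_\<Omega>] by blast
  qed
  then show ?thesis
    using ridge_estimator_eq_if_intertwines [OF inj assms(3)] by blast
qed

end
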